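(* Let $G$ be a $(5,6)$-dense graph, i.e. a graph in which every set of $5$ vertices induces a subgraph with at least $6$ edges. Then $G$ contains a strong immersion of $K_{\chi(G)}$.
   Context: All graphs are finite and simple (no loops, no parallel edges). $K_t$ denotes the complete graph on $t$ vertices and $\chi(G)$ the chromatic number of $G$. A graph is $(k,s)$-dense if every set of $k$ vertices induces a subgraph with at least $s$ edges. A graph $G$ contains an immersion of a graph $H$ if there is an injective function $\phi:V(H)\to V(G)$ such that: (1) for every edge $uv\in E(H)$ there is a path $P_{uv}$ in $G$ connecting $\phi(u)$ and $\phi(v)$; (2) the paths $\{P_{uv}: uv\in E(H)\}$ are pairwise edge-disjoint. The immersion is strong if moreover the paths $P_{uv}$ are internally disjoint from $\phi(V(H))$, i.e. no internal vertex of any $P_{uv}$ lies in $\phi(V(H))$. *)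

theory Defs
  imports "Graph_Theory.Graph_Theory"
begin

text \<open>
  A finite simple graph is an instance of the locale \<open>graph\<close>: a finite, symmetric digraph
  without loops and without parallel arcs. Every undirected edge is thus present as two opposite
  arcs, so edges are counted and compared as two-element vertex sets, never as arcs.
\<close>

definition edges :: "('a, 'b) pre_digraph \<Rightarrow> 'a set set" where
  "edges G = {{u, v} | u v. (u, v) \<in> arcs_ends G}"

definition dense :: "nat \<Rightarrow> nat \<Rightarrow> ('a, 'b) pre_digraph \<Rightarrow> bool" where
  "dense k s G \<longleftrightarrow>
     (\<forall>S. S \<subseteq> verts G \<and> card S = k \<longrightarrow> s \<le> card (edges (induce_subgraph G S)))"

definition colouring :: "('a, 'b) pre_digraph \<Rightarrow> nat \<Rightarrow> ('a \<Rightarrow> nat) \<Rightarrow> bool" where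
  "colouring G k c \<longleftrightarrow>
     (\<forall>v \<in> verts G. c v < k) \<and> (\<forall>u v. (u, v) \<in> arcs_ends G \<longrightarrow> c u \<noteq> c v)"

definition chromatic_number :: "('a, 'b) pre_digraph \<Rightarrow> nat" where
  "chromatic_number G = (LEAST k. \<exists>c. colouring G k c)"

definition complete_graph :: "nat \<Rightarrow> (nat, nat \<times> nat) pre_digraph" where
  "complete_graph t =
     with_proj \<lparr>pverts = {..<t}, parcs = {(i, j). i < t \<and> j < t \<and> i \<noteq> j}\<rparr>"

definition walk_edges :: "'a vwalk \<Rightarrow> 'a set set" where
  "walk_edges p = {{u, v} | u v. (u, v) \<in> set (vwalk_arcs p)}"

definition internal_verts :: "'a vwalk \<Rightarrow> 'a set" where
  "internal_verts p = set (butlast (tl p))"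

text \<open>
  \<open>P\<close> assigns one path to each undirected edge \<open>e\<close> of \<open>H\<close>; the direction in which
  the vertex list \<open>P e\<close> is traversed is left open, so the condition on its two ends is an equality
  of unordered pairs.
\<close>

definition immersion ::
  "('h, 'c) pre_digraph \<Rightarrow> ('a, 'b) pre_digraph \<Rightarrow> ('h \<Rightarrow> 'a) \<Rightarrow> ('h set \<Rightarrow> 'a vwalk) \<Rightarrow> bool"
where
  "immersion H G \<phi> P \<longleftrightarrow>
     \<phi> ` verts H \<subseteq> verts G \<and> inj_on \<phi> (verts H) \<and>
     (\<forall>e \<in> edges H. vpath (P e) G \<and> {hd (P e), last (P e)} = \<phi> ` e) \<and>
     (\<forall>e \<in> edges H. \<forall>f \<in> edges H. e \<noteq> f \<longrightarrow> walk_edges (P e) \<inter> walk_edges (P f) = {})"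

definition strong_immersion ::
  "('h, 'c) pre_digraph \<Rightarrow> ('a, 'b) pre_digraph \<Rightarrow> ('h \<Rightarrow> 'a) \<Rightarrow> ('h set \<Rightarrow> 'a vwalk) \<Rightarrow> bool"
where
  "strong_immersion H G \<phi> P \<longleftrightarrow>
     immersion H G \<phi> P \<and> (\<forall>e \<in> edges H. internal_verts (P e) \<inter> \<phi> ` verts H = {})"

definition contains_strong_immersion ::
  "('a, 'b) pre_digraph \<Rightarrow> ('h, 'c) pre_digraph \<Rightarrow> bool"
where
  "contains_strong_immersion G H \<longleftrightarrow> (\<exists>\<phi> P. strong_immersion H G \<phi> P)"

lemma complete_digraph_complete_graph: "complete_digraph t (complete_graph t)"
  unfolding complete_graph_def complete_digraph_pair_def by auto

lemma colouring_chromatic_number: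
  assumes "graph G"
  shows "\<exists>c. colouring G (chromatic_number G) c"
proof -
  interpret graph G by fact
  obtain c where c: "bij_betw c (verts G) {0..<card (verts G)}"
    using ex_bij_betw_finite_nat[OF finite_verts] by blast
  have "colouring G (card (verts G)) c"
    unfolding colouring_def
  proof (intro conjI ballI allI impI)
    fix v assume "v \<in> verts G"
    then show "c v < card (verts G)" using c by (auto simp: bij_betw_def)
  next
    fix u v assume uv: "(u, v) \<in> arcs_ends G"
    then have "u \<in> verts G" "v \<in> verts G" "u \<noteq> v"
      by (auto simp: arcs_ends_conv dest: no_loops)
    then show "c u \<noteq> c v" using c by (auto simp: bij_betw_def dest: inj_onD)
  qed
  then show ?thesis
    unfolding chromatic_number_def by (intro LeastI[of "\<lambda>k. \<exists>c. colouring G k c"]) blast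
qed

end

theory Submission
  imports Defs
begin

text \<open>
  Let \<open>h\<close> be non-adjacency in \<open>G\<close> and \<open>k\<close> the chromatic number. A colour class of \<open>G\<close> is a clique
  of \<open>h\<close>, and density says that five vertices span at most four edges of \<open>h\<close>. Choose a smallest
  set \<open>W\<close> of vertices that cannot be covered by fewer than \<open>k\<close> cliques of \<open>h\<close>; deleting any vertex
  of \<open>W\<close> saves a clique. This has two consequences.

  First, if \<open>a\<close> and \<open>b\<close> are joined in \<open>h\<close>, then \<open>a\<close> has a neighbour in \<open>W\<close> outside the closed
  neighbourhood of \<open>b\<close> (\<open>private_neighbour\<close>): otherwise every clique through \<open>a\<close> could absorb \<open>b\<close>.
  Together with sparsity this excludes cycles of length 3, 4 and 5 from \<open>h\<close> on \<open>W\<close>.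

  Second, let \<open>d u\<close> and \<open>d v\<close> be the degrees in \<open>W\<close> of the ends of an edge \<open>uv\<close> of \<open>h\<close>. Match each of
  the \<open>d u + d v - 2\<close> other neighbours of \<open>u\<close> and \<open>v\<close> to one of its private neighbours, and \<open>u\<close> to
  \<open>v\<close>. The lack of short cycles makes this a matching of size \<open>d u + d v - 1\<close>, and a matching of
  size \<open>m\<close> yields a cover by \<open>|W| - m\<close> cliques. So \<open>k + (d u + d v - 1) \<le> |W|\<close>
  (\<open>degree_bound\<close>).

  Now any \<open>k\<close> vertices \<open>B\<close> of \<open>W\<close> can be the branch vertices. Adjacent pairs are joined by their edge.
  A non-adjacent pair \<open>u\<close>, \<open>v\<close> is joined by a path \<open>u, w, v\<close> with \<open>w\<close> in \<open>W - B\<close> and adjacent in \<open>G\<close>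
  to both; two such paths share an edge only if their pairs share a vertex and use the same
  connector \<open>w\<close>. Choosing the connectors is thus a list edge-colouring of \<open>h\<close> on \<open>B\<close>. The list of
  \<open>uv\<close> is \<open>W - B\<close> without the neighbours of \<open>u\<close> and \<open>v\<close> in \<open>h\<close>, and the neighbours inside \<open>B\<close> count
  the conflicting edges, so each list exceeds the number of conflicts as soon as
  \<open>|W| - k \<ge> d u + d v - 1\<close>. The degree bound therefore lets the greedy choice succeed
  (\<open>exists_connectors\<close>).
\<close>

section \<open>Covering by cliques of the complement\<close>

text \<open>
  When \<open>h\<close> is non-adjacency in a graph, this is \<open>j\<close>-colourability of the subgraph on \<open>W\<close>. Cliques may
  be empty, so the property is monotone in \<open>j\<close>.
\<close>

definition clique_coverable :: "('a \<Rightarrow> 'a \<Rightarrow> bool) \<Rightarrow> 'a set \<Rightarrow> nat \<Rightarrow> bool" where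
  "clique_coverable h W j \<longleftrightarrow>
     (\<exists>c::'a \<Rightarrow> nat. (\<forall>v\<in>W. c v < j) \<and> (\<forall>u\<in>W. \<forall>v\<in>W. u \<noteq> v \<longrightarrow> c u = c v \<longrightarrow> h u v))"

lemma clique_coverable_by_labels:
  assumes "finite W" "g ` W \<subseteq> X" "finite X"
    and "\<And>u v. u \<in> W \<Longrightarrow> v \<in> W \<Longrightarrow> u \<noteq> v \<Longrightarrow> g u = g v \<Longrightarrow> h u v"
  shows "clique_coverable h W (card X)"
proof -
  obtain r where r: "bij_betw r X {0..<card X}"
    using ex_bij_betw_finite_nat[OF \<open>finite X\<close>] by blast
  show ?thesis unfolding clique_coverable_def
  proof (intro exI[of _ "r \<circ> g"] conjI ballI impI)
    fix v assume "v \<in> W" then show "(r \<circ> g) v < card X"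
      using bij_betwE[OF r] assms(2) by auto
  next
    fix u v assume *: "u \<in> W" "v \<in> W" "u \<noteq> v" "(r \<circ> g) u = (r \<circ> g) v"
    then have "g u = g v"
      using inj_onD[OF bij_betw_imp_inj_on[OF r], of "g u" "g v"] assms(2) by auto
    then show "h u v" using assms(4) * by blast
  qed
qed

text \<open>
  The matching is given by a map from one side \<open>A\<close> to the other. Its edges serve as two-element
  cliques; all remaining vertices are singletons.
\<close>

lemma clique_coverable_by_matching:
  assumes "finite W" "A \<subseteq> W" "inj_on f A" "f ` A \<subseteq> W - A"
    and sym: "\<And>x y. h x y \<Longrightarrow> h y x"
    and f: "\<And>a. a \<in> A \<Longrightarrow> h a (f a)"
  shows "clique_coverable h W (card W - card A)"
proof -
  \<comment> \<open>Each clique is labelled by its element outside \<open>f ` A\<close>.\<close>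
  define g where "g x = (if x \<in> f ` A then inv_into A f x else x)" for x
  have g: "g (f a) = a" if "a \<in> A" for a
    using that assms(3) by (simp add: g_def)
  have im: "g ` W \<subseteq> W - f ` A"
  proof
    fix y assume "y \<in> g ` W"
    then obtain x where x: "x \<in> W" "y = g x" by blast
    show "y \<in> W - f ` A"
    proof (cases "x \<in> f ` A")
      case True
      then obtain a where "a \<in> A" "x = f a" by blast
      then show ?thesis using x g assms(2,4) by auto
    qed (use x in \<open>simp add: g_def\<close>)
  qed
  have "h u v" if *: "u \<in> W" "v \<in> W" "u \<noteq> v" "g u = g v" for u v
  proof -
    consider "u \<in> f ` A" "v \<in> f ` A" | "u \<in> f ` A" "v \<notin> f ` A" | "u \<notin> f ` A" "v \<in> f ` A"
      | "u \<notin> f ` A" "v \<notin> f ` A" by blast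
    then show ?thesis
    proof cases
      case 1 then show ?thesis using * g by auto
    next
      case 2
      then obtain a where "a \<in> A" "u = f a" by blast
      moreover have "v = a" using 2 * g[OF \<open>a \<in> A\<close>] \<open>u = f a\<close> by (simp add: g_def)
      ultimately show ?thesis using f sym by blast
    next
      case 3
      then obtain a where "a \<in> A" "v = f a" by blast
      moreover have "u = a" using 3 * g[OF \<open>a \<in> A\<close>] \<open>v = f a\<close> by (simp add: g_def)
      ultimately show ?thesis using f by blast
    next
      case 4 then show ?thesis using * by (simp add: g_def)
    qed
  qed
  then have "clique_coverable h W (card (W - f ` A))"
    using clique_coverable_by_labels[OF assms(1) im] assms(1) by blast
  moreover have "card (W - f ` A) = card W - card A"
    using assms(1-4) by (subst card_Diff_subset) (auto simp: card_image intro: finite_subset)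
  ultimately show ?thesis by simp
qed

section \<open>Critical sets in locally sparse complements\<close>

text \<open>
  In the application \<open>h\<close> is non-adjacency in the dense graph, \<open>k\<close> its chromatic number and \<open>W\<close> a
  smallest vertex set that still needs \<open>k\<close> colours. Asking only that no \<open>j < k\<close> suffices, rather
  than speaking of \<open>k - 1\<close>, covers the empty graph as well.
\<close>

locale critical_set =
  fixes W :: "'a set" and h :: "'a \<Rightarrow> 'a \<Rightarrow> bool" and k :: nat
  assumes fin: "finite W"
    and sym: "h x y \<Longrightarrow> h y x"
    and irrefl: "\<not> h x x"
    and not_coverable: "j < k \<Longrightarrow> \<not> clique_coverable h W j"
    and critical: "x \<in> W \<Longrightarrow> \<exists>j<k. clique_coverable h (W - {x}) j"
    and sparse: "S \<subseteq> W \<Longrightarrow> card S = 5 \<Longrightarrow> card {{x, y} | x y. x \<in> S \<and> y \<in> S \<and> h x y} \<le> 4"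
begin

text \<open>
  A form of sparsity for explicit configurations: edges are listed as ordered pairs, one per edge, so
  that the image set can be counted by rewriting.
\<close>

lemma five_vertices_span_few_edges:
  assumes "{a, b, c, d, e} \<subseteq> W" "distinct [a, b, c, d, e]"
    and "P \<subseteq> {a, b, c, d, e} \<times> {a, b, c, d, e}" "\<forall>(x, y)\<in>P. h x y"
  shows "card ((\<lambda>(x, y). {x, y}) ` P) \<le> 4"
proof -
  let ?S = "{a, b, c, d, e}"
  let ?E = "{{x, y} | x y. x \<in> ?S \<and> y \<in> ?S \<and> h x y}"
  have "finite ?E"
    by (rule finite_subset[of _ "Pow ?S"]) blast+
  moreover have "(\<lambda>(x, y). {x, y}) ` P \<subseteq> ?E" using assms(3,4) by fast
  ultimately have "card ((\<lambda>(x, y). {x, y}) ` P) \<le> card ?E" by (intro card_mono)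
  also have "\<dots> \<le> 4" using assms(1,2) by (intro sparse) (blast, simp)
  finally show ?thesis .
qed

text \<open>
  If the clique of \<open>x\<close> lay in the neighbourhood of \<open>b\<close>, then adding \<open>b\<close> to it would cover all of
  \<open>W\<close> by too few cliques.
\<close>

lemma no_absorption:
  assumes "b \<in> W" "j < k"
    and c: "\<forall>v\<in>W - {b}. c v < j" "\<forall>u\<in>W - {b}. \<forall>v\<in>W - {b}. u \<noteq> v \<longrightarrow> c u = c v \<longrightarrow> h u v"
    and x: "x \<in> W" "x \<noteq> b"
  shows "\<exists>y\<in>W - {b}. c y = c x \<and> \<not> h y b"
proof (rule ccontr)
  assume "\<not> ?thesis"
  then have *: "h y b" if "y \<in> W - {b}" "c y = c x" for y
    using that by blast
  have "clique_coverable h W j"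
    unfolding clique_coverable_def
  proof (intro exI[of _ "c(b := c x)"] conjI ballI impI)
    fix v assume "v \<in> W" then show "(c(b := c x)) v < j" using c(1) x by auto
  next
    fix u v assume "u \<in> W" "v \<in> W" "u \<noteq> v" "(c(b := c x)) u = (c(b := c x)) v"
    then show "h u v" using c(2) * sym by (auto split: if_splits)
  qed
  then show False using not_coverable \<open>j < k\<close> by blast
qed

text \<open>
  Cover \<open>W - {b}\<close> by fewer than \<open>k\<close> cliques. The clique containing \<open>a\<close> cannot absorb \<open>b\<close>, so it has a
  member that is not a neighbour of \<open>b\<close>. In particular no vertex of \<open>W\<close> has degree one.
\<close>

lemma private_neighbour:
  assumes "a \<in> W" "b \<in> W" "h a b"
  shows "\<exists>x\<in>W. h a x \<and> x \<noteq> b \<and> \<not> h x b"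
proof -
  obtain j c where j: "j < k"
    and c: "\<forall>v\<in>W - {b}. c v < j" "\<forall>u\<in>W - {b}. \<forall>v\<in>W - {b}. u \<noteq> v \<longrightarrow> c u = c v \<longrightarrow> h u v"
    using critical[OF \<open>b \<in> W\<close>] unfolding clique_coverable_def by blast
  have "a \<noteq> b" using assms irrefl by blast
  then obtain y where y: "y \<in> W - {b}" "c y = c a" "\<not> h y b"
    using no_absorption[OF assms(2) j c assms(1)] by blast
  moreover have "y \<noteq> a" using y assms by blast
  ultimately show ?thesis using c(2) \<open>a \<noteq> b\<close> assms(1) by (intro bexI[of _ y]) auto
qed

text \<open>
  The private neighbours of \<open>b\<close> against \<open>c\<close> and of \<open>c\<close> against \<open>b\<close> are two different vertices outside
  the triangle. With the triangle they make five vertices spanning five edges.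
\<close>

lemma no_triangle:
  assumes "a \<in> W" "b \<in> W" "c \<in> W" "h a b" "h b c" "h a c"
  shows False
proof -
  obtain x where x: "x \<in> W" "h b x" "x \<noteq> c" "\<not> h x c"
    using private_neighbour[of b c] assms by blast
  obtain y where y: "y \<in> W" "h c y" "y \<noteq> b" "\<not> h y b"
    using private_neighbour[of c b] assms sym by blast
  have d: "distinct [a, b, c, x, y]"
    using x y assms irrefl sym by auto
  have "card {{a, b}, {b, c}, {a, c}, {b, x}, {c, y}} \<le> 4"
    using five_vertices_span_few_edges[of a b c x y "{(a, b), (b, c), (a, c), (b, x), (c, y)}"] x y assms d by simp
  then show False using d by (auto simp: card_insert_if doubleton_eq_iff)
qed

text \<open>
  A 4-cycle is induced, since there are no triangles, and no edge leaves it, since a fifth vertex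
  would give five edges. In a cover of \<open>W - {a}\<close>, the vertex \<open>c\<close> shares its clique with
  at most one of \<open>b\<close> and \<open>d\<close>; the other one is alone and can absorb \<open>a\<close>.
\<close>

lemma no_4_cycle:
  assumes W: "a \<in> W" "b \<in> W" "c \<in> W" "d \<in> W" and h: "h a b" "h b c" "h c d" "h d a"
    and ne: "a \<noteq> c" "b \<noteq> d"
  shows False
proof -
  have dist: "distinct [a, b, c, d]" using h ne irrefl by auto
  have outside: "\<not> h y x" if x: "x \<in> W" "x \<notin> {a, b, c, d}" and y: "y \<in> {a, b, c, d}" for x y
  proof
    have rot: False
      if "p \<in> W" "q \<in> W" "r \<in> W" "s \<in> W" "h p q" "h q r" "h r s" "h s p"
        "distinct [p, q, r, s, x]" "h p x" for p q r s
    proof -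
      have "card {{p, q}, {q, r}, {r, s}, {s, p}, {p, x}} \<le> 4"
        using five_vertices_span_few_edges[of p q r s x "{(p, q), (q, r), (r, s), (s, p), (p, x)}"] that x(1)
        by simp
      then show False using that(9) by (auto simp: card_insert_if doubleton_eq_iff)
    qed
    assume yx: "h y x"
    from y consider "y = a" | "y = b" | "y = c" | "y = d" by blast
    then show False
      using rot[of a b c d] rot[of b c d a] rot[of c d a b] rot[of d a b c] W h dist x yx
      by cases auto
  qed
  have bd: "\<not> h b d" "\<not> h d b" using no_triangle[of a b d] W h sym by blast+
  obtain j f where j: "j < k"
    and f: "\<forall>v\<in>W - {a}. f v < j" "\<forall>u\<in>W - {a}. \<forall>v\<in>W - {a}. u \<noteq> v \<longrightarrow> f u = f v \<longrightarrow> h u v"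
    using critical[OF \<open>a \<in> W\<close>] unfolding clique_coverable_def by blast
  \<comment> \<open>Since neither \<open>b\<close> nor \<open>d\<close> may absorb \<open>a\<close>, both would have to lie in the clique of \<open>c\<close>.\<close>
  have *: "f c = f x" if x: "x = b \<or> x = d" for x
  proof -
    have "x \<in> W" "x \<noteq> a" "h x a" using x W dist h sym by auto
    then obtain y where y: "y \<in> W - {a}" "f y = f x" "\<not> h y a"
      using no_absorption[OF W(1) j f, of x] by blast
    then have "y \<noteq> x" using \<open>h x a\<close> by blast
    then have "h x y" using f(2) y \<open>x \<in> W\<close> \<open>x \<noteq> a\<close> by simp
    then have "y = c" using outside[of y x] y x bd \<open>y \<noteq> x\<close> by auto
    then show ?thesis using y by simp
  qed
  have "f b = f d" using *[of b] *[of d] by simp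
  then show False using f(2) bd dist W by auto
qed

lemma no_5_cycle:
  assumes "{a, b, c, d, e} \<subseteq> W" "distinct [a, b, c, d, e]"
    and "h a b" "h b c" "h c d" "h d e" "h e a"
  shows False
proof -
  have "card {{a, b}, {b, c}, {c, d}, {d, e}, {e, a}} \<le> 4"
    using five_vertices_span_few_edges[of a b c d e "{(a, b), (b, c), (c, d), (d, e), (e, a)}"] assms by simp
  then show False using assms(2) by (auto simp: card_insert_if doubleton_eq_iff)
qed

definition nbrs :: "'a \<Rightarrow> 'a set" where
  "nbrs u = {x \<in> W. h u x}"

lemma finite_nbrs [simp]: "finite (nbrs u)"
  using fin by (simp add: nbrs_def)

lemma matching_bound: "A \<subseteq> W \<Longrightarrow> inj_on f A \<Longrightarrow> f ` A \<subseteq> W - A \<Longrightarrow> (\<And>a. a \<in> A \<Longrightarrow> h a (f a))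
    \<Longrightarrow> k + card A \<le> card W"
proof -
  assume A: "A \<subseteq> W" "inj_on f A" "f ` A \<subseteq> W - A" "\<And>a. a \<in> A \<Longrightarrow> h a (f a)"
  have "clique_coverable h W (card W - card A)"
    by (rule clique_coverable_by_matching[of W A f h, OF fin A(1-3)]) (use sym A(4) in auto)
  then have "k \<le> card W - card A" using not_coverable not_le by blast
  moreover have "card A \<le> card W" using A fin by (simp add: card_mono)
  ultimately show ?thesis by simp
qed

text \<open>
  The neighbours of \<open>u\<close> and \<open>v\<close> other than \<open>u\<close> and \<open>v\<close> form a set \<open>A\<close>, of size \<open>d u + d v - 2\<close> for
  lack of triangles. A member attached to \<open>u\<close> has a neighbour that is private in the sense that it
  is neither \<open>u\<close> nor attached to \<open>u\<close>; it is not attached to \<open>v\<close> either, for lack of 4-cycles, so it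
  lies outside \<open>A\<close>. The same holds at \<open>v\<close>. Two members of \<open>A\<close> with a common private neighbour would close a
  4-cycle (through one of \<open>u\<close>, \<open>v\<close>) or a 5-cycle (through both). Adding \<open>uv\<close> gives a matching of
  size \<open>d u + d v - 1\<close>.
\<close>

lemma degree_bound:
  assumes W: "u \<in> W" "v \<in> W" and uv: "h u v"
  shows "k + card (nbrs u) + card (nbrs v) \<le> card W + 1"
proof -
  have vu: "h v u" using uv sym by blast
  have "u \<noteq> v" using uv irrefl by blast
  define A where "A = (nbrs u - {v}) \<union> (nbrs v - {u})"
  have disj: "nbrs u \<inter> nbrs v = {}"
    using no_triangle[of u v] W uv sym by (auto simp: nbrs_def)
  have mem: "v \<in> nbrs u" "u \<in> nbrs v" using W uv vu by (auto simp: nbrs_def)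
  have notA: "u \<notin> A" "v \<notin> A" using irrefl by (auto simp: A_def nbrs_def)
  have AW: "A \<subseteq> W" by (auto simp: A_def nbrs_def)
  have "\<exists>x\<in>W. h a x \<and> x \<notin> A \<and> x \<noteq> u \<and> x \<noteq> v" if "a \<in> A" for a
  proof -
    have *: "\<exists>x\<in>W. h a x \<and> x \<notin> nbrs p \<and> x \<notin> nbrs q \<and> x \<noteq> p \<and> x \<noteq> q"
      if pq: "p \<in> W" "q \<in> W" "h p q" "a \<in> W" "h p a" "a \<noteq> q" for p q
    proof -
      obtain x where x: "x \<in> W" "h a x" "x \<noteq> p" "\<not> h x p"
        using private_neighbour[of a p] pq sym by blast
      have "x \<noteq> q" using x pq sym by blast
      moreover have "\<not> h q x"
        using no_4_cycle[of p a x q] pq x sym by blast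
      moreover have "\<not> h p x" using x sym by blast
      ultimately show ?thesis using x by (auto simp: nbrs_def)
    qed
    show ?thesis
      using that *[of u v] *[of v u] W uv vu by (auto simp: A_def nbrs_def)
  qed
  then obtain g where g: "\<And>a. a \<in> A \<Longrightarrow> g a \<in> W \<and> h a (g a) \<and> g a \<notin> A \<and> g a \<noteq> u \<and> g a \<noteq> v"
    by metis
  have inj: "inj_on g A"
  proof (rule inj_onI, rule ccontr)
    fix a b assume ab: "a \<in> A" "b \<in> A" "g a = g b" "a \<noteq> b"
    let ?x = "g a"
    have x: "?x \<in> W" "h a ?x" "h b ?x" "?x \<notin> A" "?x \<noteq> u" "?x \<noteq> v"
      using g[OF ab(1)] g[OF ab(2)] ab(3) by auto
    \<comment> \<open>\<open>same\<close>: the 4-cycle when \<open>a\<close>, \<open>b\<close> have the common neighbour \<open>p\<close>;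
      \<open>diff\<close>: the 5-cycle when they hang on opposite ends of the edge.\<close>
    have same: False if "p \<in> W" "h p a" "h p b" "?x \<noteq> p" for p
      using no_4_cycle[of p a ?x b] that ab x AW sym by blast
    have diff: False if "p \<in> W" "q \<in> W" "h p q" "h p s" "h q t" "s \<in> W" "t \<in> W"
      "s \<noteq> q" "t \<noteq> p" "h s ?x" "h t ?x" "s \<noteq> t" "?x \<noteq> p" "?x \<noteq> q" for p q s t
    proof -
      have "distinct [p, s, ?x, t, q]" using that irrefl by auto
      then show False using no_5_cycle[of p s ?x t q] that x(1) sym by blast
    qed
    show False
      using ab(1,2) unfolding A_def
    proof (elim UnE)
      assume "a \<in> nbrs u - {v}" "b \<in> nbrs u - {v}"
      then show False using same[of u] W x by (auto simp: nbrs_def)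
    next
      assume "a \<in> nbrs v - {u}" "b \<in> nbrs v - {u}"
      then show False using same[of v] W x by (auto simp: nbrs_def)
    next
      assume "a \<in> nbrs u - {v}" "b \<in> nbrs v - {u}"
      then show False using diff[of u v a b] W uv x ab(4) by (auto simp: nbrs_def)
    next
      assume "a \<in> nbrs v - {u}" "b \<in> nbrs u - {v}"
      then show False using diff[of u v b a] W uv x ab(4) by (auto simp: nbrs_def)
    qed
  qed
  define f where "f = g(u := v)"
  have "k + card (insert u A) \<le> card W"
  proof (rule matching_bound[of _ f])
    show "insert u A \<subseteq> W" using AW W by blast
    have fA: "f a = g a" if "a \<in> A" for a using that notA by (auto simp: f_def)
    have fu: "f u = v" by (simp add: f_def)
    show "inj_on f (insert u A)"
      using inj g fA fu notA by (auto simp: inj_on_def) metis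
    show "f ` insert u A \<subseteq> W - insert u A"
      using g fA fu notA W \<open>u \<noteq> v\<close> by auto
    show "h a (f a)" if "a \<in> insert u A" for a
      using that g fA fu uv by auto
  qed
  moreover have "card (insert u A) + 1 = card (nbrs u) + card (nbrs v)"
  proof -
    have "card A = card (nbrs u - {v}) + card (nbrs v - {u})"
      unfolding A_def using disj by (intro card_Un_disjoint) auto
    moreover have "card (nbrs u) = Suc (card (nbrs u - {v}))" "card (nbrs v) = Suc (card (nbrs v - {u}))"
      by (rule card.remove; use mem in simp)+
    moreover have "card (insert u A) = Suc (card A)"
      using notA AW fin by (simp add: finite_subset)
    ultimately show ?thesis by simp
  qed
  ultimately show ?thesis by linarith
qed

end

section \<open>Greedy choice of connectors\<close>

text \<open>
  Colour the elements one after the other: at most as many colours are blocked as there are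
  conflicting elements.
\<close>

lemma greedy_list_colouring:
  assumes "finite E"
    and sym: "\<And>e f. conflict e f \<Longrightarrow> conflict f e"
    and "\<And>e. e \<in> E \<Longrightarrow> card {f \<in> E. f \<noteq> e \<and> conflict e f} < card (L e)"
  shows "\<exists>w. \<forall>e\<in>E. w e \<in> L e \<and> (\<forall>f\<in>E. f \<noteq> e \<longrightarrow> conflict e f \<longrightarrow> w e \<noteq> w f)"
  using assms(1,3)
proof (induction E)
  case empty
  then show ?case by simp
next
  case (insert e E)
  have "card {f \<in> E. f \<noteq> x \<and> conflict x f} < card (L x)" if "x \<in> E" for x
  proof -
    have "card {f \<in> E. f \<noteq> x \<and> conflict x f} \<le> card {f \<in> insert e E. f \<noteq> x \<and> conflict x f}"
      using insert.hyps by (intro card_mono) auto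
    then show ?thesis using insert.prems[of x] that by simp
  qed
  then obtain w where w: "\<forall>x\<in>E. w x \<in> L x \<and> (\<forall>f\<in>E. f \<noteq> x \<longrightarrow> conflict x f \<longrightarrow> w x \<noteq> w f)"
    using insert.IH by blast
  let ?N = "{f \<in> insert e E. f \<noteq> e \<and> conflict e f}"
  have "card (w ` ?N) < card (L e)"
    using insert.prems[of e] insert.hyps card_image_le[of ?N w] by simp
  then have "\<not> L e \<subseteq> w ` ?N"
    using insert.hyps card_mono[of "w ` ?N" "L e"] by auto
  then obtain y where "y \<in> L e" "y \<notin> w ` ?N" by blast
  show ?case
  proof (intro exI[of _ "w(e := y)"] ballI conjI impI)
    show "(w(e := y)) x \<in> L x" if "x \<in> insert e E" for x
      using that w \<open>y \<in> L e\<close> by auto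
    have new: "y \<noteq> w f" if "f \<in> E" "f \<noteq> e" "conflict e f" for f
      using that \<open>y \<notin> w ` ?N\<close> by blast
    show "(w(e := y)) x \<noteq> (w(e := y)) f"
      if "x \<in> insert e E" "f \<in> insert e E" "f \<noteq> x" "conflict x f" for x f
      using that w new[of f] new[of x] sym[of x f] by auto
  qed
qed

context critical_set
begin

text \<open>
  The edges of \<open>h\<close> inside \<open>B\<close> are coloured greedily with vertices of \<open>W - B\<close>. Of the neighbours of
  the ends of an edge \<open>uv\<close>, those inside \<open>B\<close> (apart from \<open>u\<close> and \<open>v\<close>) give the conflicting edges and
  those outside \<open>B\<close> are the forbidden colours, so both together are paid for by one use of the
  degree bound. Only the condition at \<open>u\<close> is stated, because \<open>{u, v}\<close> is symmetric in its elements.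
\<close>

lemma exists_connectors:
  assumes B: "B \<subseteq> W" "card B = k"
  shows "\<exists>w. (\<forall>u\<in>B. \<forall>v\<in>B. h u v \<longrightarrow> w {u, v} \<in> W - B \<and> \<not> h u (w {u, v})) \<and>
    (\<forall>u\<in>B. \<forall>v\<in>B. \<forall>x\<in>B. h u v \<longrightarrow> h u x \<longrightarrow> v \<noteq> x \<longrightarrow> w {u, v} \<noteq> w {u, x})"
proof -
  define E where "E = {{u, v} | u v. u \<in> B \<and> v \<in> B \<and> h u v}"
  define L where "L e = {x \<in> W - B. \<forall>u\<in>e. \<not> h u x}" for e
  have finB: "finite B" using B fin finite_subset by blast
  have finE: "finite E" 
    by (rule finite_subset[of _ "Pow B"]) (use finB in \<open>auto simp: E_def\<close>)
  have cardC: "card (W - B) + k = card W"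
    using B fin finB card_mono[OF fin B(1)] by (simp add: card_Diff_subset)
  have few: "card {f \<in> E. f \<noteq> e \<and> e \<inter> f \<noteq> {}} < card (L e)" if eE: "e \<in> E" for e
  proof -
    obtain u v where e: "e = {u, v}" and uvB: "u \<in> B" "v \<in> B" and uv: "h u v"
      using eE by (auto simp: E_def)
    have vu: "h v u" using uv sym by blast
    \<comment> \<open>The edges from \<open>x\<close> into \<open>B\<close> other than \<open>xy\<close>.\<close>
    define P where "P x y = (\<lambda>z. {x, z}) ` (nbrs x \<inter> B - {y})" for x y
    have P: "card (P x y) + 1 \<le> card (nbrs x \<inter> B)" if "y \<in> nbrs x \<inter> B" for x y
    proof -
      have "card (P x y) \<le> card (nbrs x \<inter> B - {y})"
        unfolding P_def by (intro card_image_le) simp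
      moreover have "card (nbrs x \<inter> B) = Suc (card (nbrs x \<inter> B - {y}))"
        using that by (intro card.remove) auto
      ultimately show ?thesis by simp
    qed
    have "{f \<in> E. f \<noteq> e \<and> e \<inter> f \<noteq> {}} \<subseteq> P u v \<union> P v u"
    proof
      fix f assume f: "f \<in> {f \<in> E. f \<noteq> e \<and> e \<inter> f \<noteq> {}}"
      then obtain p q where pq: "f = {p, q}" "p \<in> B" "q \<in> B" "h p q" by (auto simp: E_def)
      have "h q p" using pq sym by blast
      have nb: "q \<in> nbrs p" "p \<in> nbrs q" using pq \<open>h q p\<close> B by (auto simp: nbrs_def)
      have "p = u \<or> p = v \<or> q = u \<or> q = v" using f e pq by auto
      then show "f \<in> P u v \<union> P v u"
        using f e pq nb unfolding P_def by (auto simp: insert_commute image_iff)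
    qed
    then have "card {f \<in> E. f \<noteq> e \<and> e \<inter> f \<noteq> {}} \<le> card (P u v \<union> P v u)"
      by (intro card_mono) (auto simp: P_def)
    also have "\<dots> \<le> card (P u v) + card (P v u)" by (rule card_Un_le)
    finally have 1: "card {f \<in> E. f \<noteq> e \<and> e \<inter> f \<noteq> {}} + 2 \<le> card (nbrs u \<inter> B) + card (nbrs v \<inter> B)"
      using P[of v u] P[of u v] uv vu uvB subsetD[OF B(1)] by (auto simp: nbrs_def)
    have "W - B \<subseteq> L e \<union> (nbrs u - B) \<union> (nbrs v - B)"
      by (auto simp: L_def nbrs_def e)
    then have "card (W - B) \<le> card (L e \<union> (nbrs u - B) \<union> (nbrs v - B))"
      using fin by (intro card_mono) (auto simp: L_def)
    also have "\<dots> \<le> card (L e) + card (nbrs u - B) + card (nbrs v - B)"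
      by (meson card_Un_le add_le_mono1 order_trans)
    finally have 2: "card (W - B) \<le> card (L e) + card (nbrs u - B) + card (nbrs v - B)" .
    have 3: "card (nbrs x \<inter> B) + card (nbrs x - B) = card (nbrs x)" for x
      by (metis card_Int_Diff finite_nbrs)
    show ?thesis
      using 1 2 3[of u] 3[of v] cardC degree_bound[of u v] uvB B uv by fastforce
  qed
  obtain w where w: "\<forall>e\<in>E. w e \<in> L e \<and> (\<forall>f\<in>E. f \<noteq> e \<longrightarrow> e \<inter> f \<noteq> {} \<longrightarrow> w e \<noteq> w f)"
    using greedy_list_colouring[of E "\<lambda>e f. e \<inter> f \<noteq> {}" L] finE few by (auto simp: Int_commute)
  have inE: "{u, v} \<in> E" if "u \<in> B" "v \<in> B" "h u v" for u v
    using that by (auto simp: E_def)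
  show ?thesis
  proof (intro exI[of _ w] conjI ballI impI)
    fix u v assume "u \<in> B" "v \<in> B" "h u v"
    then show "w {u, v} \<in> W - B" "\<not> h u (w {u, v})" using w inE by (auto simp: L_def)
  next
    fix u v x assume "u \<in> B" "v \<in> B" "x \<in> B" "h u v" "h u x" "v \<noteq> x"
    then show "w {u, v} \<noteq> w {u, x}"
      using w inE[of u v] inE[of u x] by (auto simp: doubleton_eq_iff)
  qed
qed

end

section \<open>Immersions with paths of length at most two\<close>

lemma edges_complete_graph: "edges (complete_graph t) = {{i, j} | i j. i < t \<and> j < t \<and> i \<noteq> j}"
  by (auto simp: edges_def complete_graph_def arcs_ends_def arc_to_ends_def with_proj_def)

lemma verts_complete_graph: "verts (complete_graph t) = {..<t}"
  by (simp add: complete_graph_def with_proj_def)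

text \<open>
  Every connector lies outside \<open>B\<close>, so a path through a connector has no edge in common with a direct
  one, and an edge shared by two paths of length two determines a common end and a common connector.
  The third hypothesis rules this out.
\<close>

lemma strong_immersion_by_connectors:
  fixes G :: "('a, 'b) pre_digraph" and w :: "'a set \<Rightarrow> 'a"
  assumes "graph G" "B \<subseteq> verts G"
    and conn: "\<And>u v. u \<in> B \<Longrightarrow> v \<in> B \<Longrightarrow> u \<noteq> v \<Longrightarrow> (u, v) \<notin> arcs_ends G \<Longrightarrow>
      w {u, v} \<in> verts G - B \<and> (u, w {u, v}) \<in> arcs_ends G"
    and dist: "\<And>u v x. u \<in> B \<Longrightarrow> v \<in> B \<Longrightarrow> x \<in> B \<Longrightarrow> u \<noteq> v \<Longrightarrow> u \<noteq> x \<Longrightarrow> v \<noteq> x \<Longrightarrow>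
      (u, v) \<notin> arcs_ends G \<Longrightarrow> (u, x) \<notin> arcs_ends G \<Longrightarrow> w {u, v} \<noteq> w {u, x}"
  shows "contains_strong_immersion G (complete_graph (card B))"
proof -
  interpret graph G by fact
  have sym: "(y, x) \<in> arcs_ends G" if "(x, y) \<in> arcs_ends G" for x y
    using arcs_ends_symmetric[OF sym_arcs that] .
  have "finite B" using assms(2) finite_verts finite_subset by blast
  then obtain \<phi> where bij: "bij_betw \<phi> {0..<card B} B"
    using ex_bij_betw_nat_finite by blast
  then have inj: "inj_on \<phi> {..<card B}" and img: "\<phi> ` {..<card B} = B"
    by (auto simp: bij_betw_def lessThan_atLeast0)
  define path where "path u v = (if (u, v) \<in> arcs_ends G then [u, v] else [u, w {u, v}, v])" for u v
  define P where "P e = path (\<phi> (Min e)) (\<phi> (Max e))" for e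
  have E: "\<exists>u v. u \<in> B \<and> v \<in> B \<and> u \<noteq> v \<and> \<phi> ` e = {u, v} \<and> P e = path u v"
    if e: "e \<in> edges (complete_graph (card B))" for e
  proof -
    obtain i j where "e = {i, j}" "i < j" "j < card B"
      using e unfolding edges_complete_graph by (auto simp: insert_commute neq_iff)
    then show ?thesis
      using inj img by (intro exI[of _ "\<phi> i"] exI[of _ "\<phi> j"]) (auto simp: P_def inj_on_def)
  qed
  have path: "vpath (path u v) G \<and> hd (path u v) = u \<and> last (path u v) = v
      \<and> internal_verts (path u v) \<inter> B = {}"
    if uv: "u \<in> B" "v \<in> B" "u \<noteq> v" for u v
  proof (cases "(u, v) \<in> arcs_ends G")
    case True
    then show ?thesis using uv assms(2) by (auto simp: path_def vpath_def vwalk_def internal_verts_def)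
  next
    case False
    have "w {u, v} \<in> verts G - B" "(u, w {u, v}) \<in> arcs_ends G" using conn[OF uv False] by auto
    moreover have "(v, w {u, v}) \<in> arcs_ends G"
      using conn[of v u] uv False sym by (auto simp: insert_commute)
    ultimately show ?thesis
      using False uv assms(2) sym by (auto simp: path_def vpath_def vwalk_def internal_verts_def)
  qed
  have path_edges: "walk_edges (path u v) = (if (u, v) \<in> arcs_ends G then {{u, v}} else
      {{u, w {u, v}}, {w {u, v}, v}})" for u v
    by (auto simp: path_def walk_edges_def)
  have half_edge: "\<exists>x p. s = {x, w {u, v}} \<and> {u, v} = {x, p} \<and> x \<in> B \<and> p \<in> B \<and> x \<noteq> p
      \<and> (x, p) \<notin> arcs_ends G"
    if uv: "u \<in> B" "v \<in> B" "u \<noteq> v" "(u, v) \<notin> arcs_ends G" and s: "s \<in> walk_edges (path u v)" for u v s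
  proof -
    have "(v, u) \<notin> arcs_ends G" using uv(4) sym by blast
    moreover have "s = {u, w {u, v}} \<or> s = {v, w {u, v}}" using uv(4) s by (auto simp: path_edges)
    moreover have "{u, v} = {v, u}" by (rule insert_commute)
    ultimately show ?thesis using uv
      by (elim disjE) (rule exI[of _ u], rule exI[of _ v], simp, rule exI[of _ v], rule exI[of _ u], simp)
  qed
  have disj: "{u, v} = {u', v'}"
    if uv: "u \<in> B" "v \<in> B" "u \<noteq> v" "u' \<in> B" "v' \<in> B" "u' \<noteq> v'"
      and s: "s \<in> walk_edges (path u v)" "s \<in> walk_edges (path u' v')" for u v u' v' s
  proof -
    have shared: "{u, v} = {u', v'}"
      if "x \<in> B" "p \<in> B" "q \<in> B" "{u, v} = {x, p}" "{u', v'} = {x, q}" "x \<noteq> p" "x \<noteq> q"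
        "(x, p) \<notin> arcs_ends G" "(x, q) \<notin> arcs_ends G" "w {u, v} = w {u', v'}" for x p q
      using dist[of x p q] that by metis
    show ?thesis
    proof (cases "(u, v) \<in> arcs_ends G"; cases "(u', v') \<in> arcs_ends G")
      assume "(u, v) \<in> arcs_ends G" "(u', v') \<in> arcs_ends G"
      then show ?thesis using s by (simp add: path_edges)
    next
      assume *: "(u, v) \<in> arcs_ends G" "(u', v') \<notin> arcs_ends G"
      have "w {u', v'} \<notin> B" using conn[of u' v'] uv * by auto
      then show ?thesis using s uv * by (auto simp: path_edges doubleton_eq_iff)
    next
      assume *: "(u, v) \<notin> arcs_ends G" "(u', v') \<in> arcs_ends G"
      have "w {u, v} \<notin> B" using conn[of u v] uv * by auto
      then show ?thesis using s uv * by (auto simp: path_edges doubleton_eq_iff)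
    next
      assume *: "(u, v) \<notin> arcs_ends G" "(u', v') \<notin> arcs_ends G"
      have out: "w {u, v} \<notin> B" "w {u', v'} \<notin> B" using conn[of u v] conn[of u' v'] uv * by auto
      obtain x p where x: "s = {x, w {u, v}}" "{u, v} = {x, p}" "x \<in> B" "p \<in> B" "x \<noteq> p"
        "(x, p) \<notin> arcs_ends G"
        using half_edge[OF uv(1-3) *(1) s(1)] by blast
      obtain y q where y: "s = {y, w {u', v'}}" "{u', v'} = {y, q}" "y \<in> B" "q \<in> B" "y \<noteq> q"
        "(y, q) \<notin> arcs_ends G"
        using half_edge[OF uv(4-6) *(2) s(2)] by blast
      have "x = y \<and> w {u, v} = w {u', v'}"
        using x(1,3) y(1,3) out by (metis doubleton_eq_iff)
      then show ?thesis using shared[of x p q] x y by metis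
    qed
  qed
  have "strong_immersion (complete_graph (card B)) G \<phi> P"
    unfolding strong_immersion_def immersion_def verts_complete_graph img
  proof (intro conjI ballI impI)
    fix e assume "e \<in> edges (complete_graph (card B))"
    then obtain u v where "u \<in> B" "v \<in> B" "u \<noteq> v" "\<phi> ` e = {u, v}" "P e = path u v" using E by blast
    then show "vpath (P e) G" "{hd (P e), last (P e)} = \<phi> ` e" "internal_verts (P e) \<inter> B = {}"
      using path by auto
  next
    fix e f assume ef: "e \<in> edges (complete_graph (card B))" "f \<in> edges (complete_graph (card B))" "e \<noteq> f"
    obtain u v where u: "u \<in> B" "v \<in> B" "u \<noteq> v" "\<phi> ` e = {u, v}" "P e = path u v" using E ef by blast
    obtain u' v' where u': "u' \<in> B" "v' \<in> B" "u' \<noteq> v'" "\<phi> ` f = {u', v'}" "P f = path u' v'"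
      using E ef by blast
    have "e \<subseteq> {..<card B}" "f \<subseteq> {..<card B}" using ef unfolding edges_complete_graph by auto
    then have "\<phi> ` e \<noteq> \<phi> ` f" using inj ef(3) by (simp add: inj_on_image_eq_iff)
    then show "walk_edges (P e) \<inter> walk_edges (P f) = {}"
      using disj[of u v u' v'] u u' by auto
  qed (use assms(2) inj in auto)
  then show ?thesis unfolding contains_strong_immersion_def by blast
qed

section \<open>Dense graphs\<close>

text \<open>
  Of the ten pairs in \<open>S\<close> at least six are edges.
\<close>

lemma sparse_complement:
  fixes G :: "('a, 'b) pre_digraph"
  assumes "graph G" "dense 5 6 G" "S \<subseteq> verts G" "card S = 5"
  shows "card {{x, y} | x y. x \<in> S \<and> y \<in> S \<and> x \<noteq> y \<and> (x, y) \<notin> arcs_ends G} \<le> 4"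
proof -
  interpret graph G by fact
  let ?N = "{{x, y} | x y. x \<in> S \<and> y \<in> S \<and> x \<noteq> y \<and> (x, y) \<notin> arcs_ends G}"
  let ?A = "edges (induce_subgraph G S)"
  let ?P = "{T. T \<subseteq> S \<and> card T = 2}"
  have finS: "finite S" using assms(4) card.infinite by fastforce
  have A: "?A \<subseteq> {{x, y} | x y. x \<in> S \<and> y \<in> S \<and> x \<noteq> y \<and> (x, y) \<in> arcs_ends G}"
    unfolding edges_def by (fastforce simp: arcs_ends_conv induce_subgraph_def dest: no_loops)
  have sym: "(y, x) \<in> arcs_ends G" if "(x, y) \<in> arcs_ends G" for x y
    using arcs_ends_symmetric[OF sym_arcs that] .
  have "?A \<inter> ?N = {}" using A sym by (fastforce simp: doubleton_eq_iff)
  moreover have sub: "?A \<subseteq> ?P" "?N \<subseteq> ?P" using A by (fastforce simp: card_2_iff)+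
  have finP: "finite ?P" using finS by simp
  ultimately have "card ?A + card ?N = card (?A \<union> ?N)"
    by (intro card_Un_disjoint[symmetric]) (auto intro: finite_subset[OF sub(1)] finite_subset[OF sub(2)])
  also have "\<dots> \<le> card ?P" using sub finP by (intro card_mono) auto
  also have "\<dots> = 5 choose 2" using n_subsets[OF finS, of 2] assms(4) by simp
  also have "\<dots> = 10" by (simp add: choose_two)
  finally have "card ?A + card ?N \<le> 10" .
  moreover have "6 \<le> card ?A" using assms(2-4) unfolding dense_def by blast
  ultimately show ?thesis by linarith
qed

lemma chromatic_number_le_clique_cover:
  assumes "graph G" "clique_coverable (\<lambda>u v. u \<noteq> v \<and> (u, v) \<notin> arcs_ends G) (verts G) j"
  shows "chromatic_number G \<le> j"
proof -
  interpret graph G by fact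
  obtain c :: "'a \<Rightarrow> nat" where c: "\<forall>v\<in>verts G. c v < j"
    "\<forall>u\<in>verts G. \<forall>v\<in>verts G. u \<noteq> v \<longrightarrow> c u = c v \<longrightarrow> u \<noteq> v \<and> (u, v) \<notin> arcs_ends G"
    using assms(2) unfolding clique_coverable_def by auto
  have "colouring G j c"
    unfolding colouring_def
  proof (intro conjI allI impI)
    fix u v assume uv: "(u, v) \<in> arcs_ends G"
    then have "u \<in> verts G" "v \<in> verts G" "u \<noteq> v"
      by (auto simp: arcs_ends_conv dest: no_loops)
    then show "c u \<noteq> c v" using c(2) uv by blast
  qed (rule c(1))
  then show ?thesis unfolding chromatic_number_def by (intro Least_le) blast
qed

theorem theorem1p3:
  fixes G :: "('a, 'b) pre_digraph"
  assumes "graph G"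
    and "dense 5 6 G"
  shows "contains_strong_immersion G (complete_graph (chromatic_number G))"
proof -
  interpret graph G by fact
  define h where "h u v \<longleftrightarrow> u \<noteq> v \<and> (u, v) \<notin> arcs_ends G" for u v
  let ?k = "chromatic_number G"
  define bad where "bad W \<longleftrightarrow> W \<subseteq> verts G \<and> (\<forall>j<?k. \<not> clique_coverable h W j)" for W
  have "bad (verts G)"
    using chromatic_number_le_clique_cover[OF assms(1)] unfolding bad_def h_def
    by (meson not_le subset_refl)
  then obtain W where W: "bad W" and min: "\<And>W'. bad W' \<Longrightarrow> card W \<le> card W'"
    using ex_has_least_nat[of bad "verts G" card] by blast
  have WV: "W \<subseteq> verts G" using W by (simp add: bad_def)
  have finW: "finite W" using WV finite_verts finite_subset by blast
  interpret critical_set W h ?k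
  proof
    show "finite W" by (fact finW)
    show "h x y \<Longrightarrow> h y x" for x y using arcs_ends_symmetric[OF sym_arcs, of y x] by (auto simp: h_def)
    show "\<not> h x x" for x by (simp add: h_def)
    show "\<not> clique_coverable h W j" if "j < ?k" for j using W that by (simp add: bad_def)
    show "\<exists>j<?k. clique_coverable h (W - {x}) j" if "x \<in> W" for x
    proof -
      have "\<not> bad (W - {x})" using min[of "W - {x}"] that finW card_Diff1_less[of W x] by linarith
      then show ?thesis using WV by (auto simp: bad_def)
    qed
    show "card {{x, y} | x y. x \<in> S \<and> y \<in> S \<and> h x y} \<le> 4" if "S \<subseteq> W" "card S = 5" for S
      using sparse_complement[OF assms, of S] that WV by (simp add: h_def)
  qed
  \<comment> \<open>The empty matching covers \<open>W\<close> by singletons.\<close>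
  have "?k \<le> card W" using matching_bound[of "{}" id] by simp
  then obtain B where B: "B \<subseteq> W" "card B = ?k" using obtain_subset_with_card_n by metis
  obtain w where w: "\<forall>u\<in>B. \<forall>v\<in>B. h u v \<longrightarrow> w {u, v} \<in> W - B \<and> \<not> h u (w {u, v})"
    "\<forall>u\<in>B. \<forall>v\<in>B. \<forall>x\<in>B. h u v \<longrightarrow> h u x \<longrightarrow> v \<noteq> x \<longrightarrow> w {u, v} \<noteq> w {u, x}"
    using exists_connectors[OF B] by blast
  have "contains_strong_immersion G (complete_graph (card B))"
  proof (rule strong_immersion_by_connectors[of G B w])
    fix u v assume *: "u \<in> B" "v \<in> B" "u \<noteq> v" "(u, v) \<notin> arcs_ends G"
    then have "w {u, v} \<in> W - B" "\<not> h u (w {u, v})" using w(1) by (auto simp: h_def)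
    then show "w {u, v} \<in> verts G - B \<and> (u, w {u, v}) \<in> arcs_ends G"
      using WV * by (auto simp: h_def)
  next
    show "w {u, v} \<noteq> w {u, x}"
      if "u \<in> B" "v \<in> B" "x \<in> B" "u \<noteq> v" "u \<noteq> x" "v \<noteq> x"
        "(u, v) \<notin> arcs_ends G" "(u, x) \<notin> arcs_ends G" for u v x
      using w(2) that by (simp add: h_def)
  qed (use assms B WV in auto)
  then show ?thesis using B by simp
qed

end
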